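(* Let $K\subset X$ be a connected subset of a metric space $X$, and let $Y$ be a totally disconnected metric space. Then for every continuous mapping $f\colon X\to Y$ we have $\operatorname{dis} f\ge \operatorname{diam} K$, and therefore $2d^c_{GH}(X,Y)\ge \operatorname{diam} K$. In particular, if $X$ is a connected metric space and $Y$ is a totally disconnected metric space such that $\operatorname{diam} X\ge \operatorname{diam} Y$, then $2d^c_{GH}(X,Y)=\operatorname{diam} X$. For example, for connected $X$ this equality holds for any discrete $\varepsilon$-net $Y\subset X$.
   Context: All metric spaces are non-empty; $|xx'|$ denotes the distance between points $x,x'$; $\operatorname{diam}$ is the supremum of pairwise distances. A topological space is totally disconnected if all its connected components are singletons. An $\varepsilon$-net in $X$ is a subset such that every point of $X$ is within distance $\varepsilon$ of it; it is discrete if its induced topology is discrete. For maps $f\colon X\to Y$ and $g\colon Y\to X$ put $$\operatorname{dis} f=\sup_{x,x'\in X}\bigl||xx'|-|f(x)f(x')|\bigr|,\qquad \operatorname{codis}(f,g)=\sup_{x\in X,\,y\in Y}\bigl||x\,g(y)|-|f(x)\,y|\bigr|$$ ($\operatorname{dis} g$ is defined analogously). The continuous Gromov--Hausdorff distance is $d^c_{GH}(X,Y)=\frac12\inf\max\{\operatorname{dis} f,\operatorname{dis} g,\operatorname{codis}(f,g)\}\in[0,\infty]$, the infimum being over all continuous maps $f\colon X\to Y$ and $g\colon Y\to X$. *)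

theory Defs
  imports "HOL-Analysis.Analysis"
begin

text \<open>Metric spaces are values of the library type \<open>'a metric\<close>, i.e. a carrier
  together with a distance, so that subsets are metric spaces via \<open>submetric\<close>.
  All suprema and infima are taken in \<open>[0,\<infinity>]\<close>, rendered as \<open>ennreal\<close>.\<close>

text \<open>The library's \<open>diameter\<close> is real-valued and \<open>0\<close> on unbounded sets, hence unsuitable.
  By convention the diameter of the empty set is \<open>0\<close>.\<close>

definition ediam :: "'a metric \<Rightarrow> 'a set \<Rightarrow> ennreal" where
  "ediam X S = (SUP (x, x') \<in> S \<times> S. ennreal (mdist X x x'))"

definition totally_disconnected_space :: "'a topology \<Rightarrow> bool" where
  "totally_disconnected_space T \<longleftrightarrow> (\<forall>C \<in> connected_components_of T. \<exists>x. C = {x})"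

definition eps_net :: "'a metric \<Rightarrow> real \<Rightarrow> 'a set \<Rightarrow> bool" where
  "eps_net X \<epsilon> N \<longleftrightarrow> N \<subseteq> mspace X \<and> (\<forall>x \<in> mspace X. \<exists>y \<in> N. mdist X x y \<le> \<epsilon>)"

definition discrete_subset :: "'a metric \<Rightarrow> 'a set \<Rightarrow> bool" where
  "discrete_subset X N \<longleftrightarrow> subtopology (mtopology_of X) N = discrete_topology N"

definition dis :: "'a metric \<Rightarrow> 'b metric \<Rightarrow> ('a \<Rightarrow> 'b) \<Rightarrow> ennreal" where
  "dis X Y f = (SUP (x, x') \<in> mspace X \<times> mspace X.
     ennreal \<bar>mdist X x x' - mdist Y (f x) (f x')\<bar>)"

definition codis :: "'a metric \<Rightarrow> 'b metric \<Rightarrow> ('a \<Rightarrow> 'b) \<Rightarrow> ('b \<Rightarrow> 'a) \<Rightarrow> ennreal" where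
  "codis X Y f g = (SUP (x, y) \<in> mspace X \<times> mspace Y.
     ennreal \<bar>mdist X x (g y) - mdist Y (f x) y\<bar>)"

definition dGHc :: "'a metric \<Rightarrow> 'b metric \<Rightarrow> ennreal" where
  "dGHc X Y =
     (INF (f, g) \<in> {(f, g). continuous_map (mtopology_of X) (mtopology_of Y) f \<and>
                            continuous_map (mtopology_of Y) (mtopology_of X) g}.
        max (dis X Y f) (max (dis Y X g) (codis X Y f g))) / 2"

end

theory Submission
  imports Defs
begin

text \<open>A continuous map into a totally disconnected space collapses a connected set \<open>K\<close> to a point,
  so its distortion is at least the diameter of \<open>K\<close>. Conversely, a pair of constant maps has
  distortions \<open>diam X\<close> and \<open>diam Y\<close>, and codistortion at most their maximum.\<close>

lemma mdist_le_ediam: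
  assumes "x \<in> S" "x' \<in> S"
  shows "ennreal (mdist X x x') \<le> ediam X S"
  unfolding ediam_def using assms by (intro SUP_upper2[of "(x, x')"]) auto

text \<open>Passing to a subspace keeps the distances and only shrinks the set of pairs. This
  supplies the diameter hypothesis for nets.\<close>

lemma ediam_submetric_le: "ediam (submetric X N) (mspace (submetric X N)) \<le> ediam X (mspace X)"
  unfolding ediam_def by (auto intro!: SUP_subset_mono)

text \<open>Cancelling the factor 2 is valid in \<open>ennreal\<close>, even for an infinite
  infimum, as 2 is neither 0 nor infinite. Both bounds can then address the infimum
  directly.\<close>

lemma two_times_dGHc:
  "2 * dGHc X Y =
     (INF (f, g) \<in> {(f, g). continuous_map (mtopology_of X) (mtopology_of Y) f \<and>
                            continuous_map (mtopology_of Y) (mtopology_of X) g}.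
        max (dis X Y f) (max (dis Y X g) (codis X Y f g)))"
  unfolding dGHc_def
  by (subst ennreal_times_divide, subst mult.commute, rule ennreal_mult_divide_eq) auto

text \<open>By maximality, \<open>C\<close> lies in the connected component of \<open>x\<close>,
  which is a singleton.\<close>

lemma connectedin_totally_disconnected_space:
  assumes "totally_disconnected_space T" "connectedin T C" "x \<in> C" "y \<in> C"
  shows "x = y"
proof -
  have "x \<in> topspace T"
    using assms(2,3) connectedin_subset_topspace by blast
  then have "connected_component_of_set T x \<in> connected_components_of T"
    by (simp add: connected_component_in_connected_components_of)
  then obtain z where "connected_component_of_set T x = {z}"
    using assms(1) unfolding totally_disconnected_space_def by blast
  then show ?thesis
    using connected_component_of_maximal[OF assms(2,3)] assms(3,4) by auto
qed

lemma totally_disconnected_space_discrete_topology: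
  "totally_disconnected_space (discrete_topology N)"
  unfolding totally_disconnected_space_def
proof
  fix C assume C: "C \<in> connected_components_of (discrete_topology N)"
  then have "connectedin (discrete_topology N) C" "C \<noteq> {}"
    by (simp_all add: connectedin_connected_components_of nonempty_connected_components_of)
  then show "\<exists>x. C = {x}"
    by (auto simp: connectedin_discrete_topology)
qed

lemma ediam_le_dis:
  assumes Y: "totally_disconnected_space (mtopology_of Y)"
    and K: "connectedin (mtopology_of X) K"
    and f: "continuous_map (mtopology_of X) (mtopology_of Y) f"
  shows "ediam X K \<le> dis X Y f"
  unfolding ediam_def
proof (clarsimp intro!: SUP_least)
  fix x x' assume x: "x \<in> K" "x' \<in> K"
  have fK: "connectedin (mtopology_of Y) (f ` K)"
    using f K by (rule connectedin_continuous_map_image)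
  have "f x = f x'"
    using x by (intro connectedin_totally_disconnected_space[OF Y fK]) auto
  moreover have "K \<subseteq> mspace X"
    using connectedin_subset_topspace[OF K] by simp
  ultimately have "x \<in> mspace X" "x' \<in> mspace X" "mdist Y (f x) (f x') = 0"
    using x continuous_map_image_subset_topspace[OF f] by (auto simp: image_subset_iff)
  \<comment> \<open>The images coincide, so the term of the supremum at \<open>(x, x')\<close> is
    the full distance \<open>mdist X x x'\<close>.\<close>
  then show "ennreal (mdist X x x') \<le> dis X Y f"
    unfolding dis_def by (intro SUP_upper2[of "(x, x')"]) auto
qed

text \<open>For every admissible pair \<open>(f, g)\<close>, the maximum under the infimum is at
  least \<open>dis X Y f\<close>.\<close>

lemma ediam_le_two_times_dGHc:
  assumes "totally_disconnected_space (mtopology_of Y)" "connectedin (mtopology_of X) K"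
  shows "ediam X K \<le> 2 * dGHc X Y"
  unfolding two_times_dGHc
  by (auto intro!: INF_greatest simp: le_max_iff_disj ediam_le_dis[OF assms])

lemma two_times_dGHc_le_max_ediam:
  assumes "mspace X \<noteq> {}" "mspace Y \<noteq> {}"
  shows "2 * dGHc X Y \<le> max (ediam X (mspace X)) (ediam Y (mspace Y))"
proof -
  obtain a b where a: "a \<in> mspace X" and b: "b \<in> mspace Y"
    using assms by blast
  have "codis X Y (\<lambda>_. b) (\<lambda>_. a) \<le> max (ediam X (mspace X)) (ediam Y (mspace Y))"
    unfolding codis_def
  proof (clarsimp intro!: SUP_least)
    fix x y assume x: "x \<in> mspace X" and y: "y \<in> mspace Y"
    \<comment> \<open>Two nonnegative reals differ by at most the larger one, so the bound is a
      maximum of diameters and not their sum.\<close>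
    have "\<bar>mdist X x a - mdist Y b y\<bar> \<le> max (mdist X x a) (mdist Y b y)"
      using mdist_nonneg[of X x a] mdist_nonneg[of Y b y] by linarith
    then have "ennreal \<bar>mdist X x a - mdist Y b y\<bar>
        \<le> max (ennreal (mdist X x a)) (ennreal (mdist Y b y))"
      by (auto simp: le_max_iff_disj ennreal_leI)
    also have "\<dots> \<le> max (ediam X (mspace X)) (ediam Y (mspace Y))"
      by (intro max.mono mdist_le_ediam x y a b)
    finally show "ennreal \<bar>mdist X x a - mdist Y b y\<bar>
        \<le> max (ediam X (mspace X)) (ediam Y (mspace Y))" .
  qed
  moreover have "mdist X a a = 0" "mdist Y b b = 0"
    using a b by simp_all
  then have "dis X Y (\<lambda>_. b) = ediam X (mspace X)" "dis Y X (\<lambda>_. a) = ediam Y (mspace Y)"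
    by (simp_all add: dis_def ediam_def)
  ultimately show ?thesis
    unfolding two_times_dGHc using a b
    by (intro INF_lower2[of "(\<lambda>_. b, \<lambda>_. a)"]) auto
qed

lemma two_times_dGHc_eq_ediam:
  assumes "mspace X \<noteq> {}" "mspace Y \<noteq> {}"
    and "totally_disconnected_space (mtopology_of Y)" "connected_space (mtopology_of X)"
    and "ediam Y (mspace Y) \<le> ediam X (mspace X)"
  shows "2 * dGHc X Y = ediam X (mspace X)"
proof (rule antisym)
  show "2 * dGHc X Y \<le> ediam X (mspace X)"
    using two_times_dGHc_le_max_ediam[OF assms(1,2)] assms(5) by (simp add: max_absorb1)
  show "ediam X (mspace X) \<le> 2 * dGHc X Y"
    \<comment> \<open>The lower bound is applied with the whole carrier as \<open>K\<close>.\<close>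
    using assms(4) connectedin_topspace[of "mtopology_of X"]
    by (intro ediam_le_two_times_dGHc assms(3)) simp
qed

theorem proposition4p9:
  fixes X :: "'a metric"
  assumes "mspace X \<noteq> {}"
  shows
    "(\<forall>(Y :: 'b metric) K.
        mspace Y \<noteq> {} \<and> totally_disconnected_space (mtopology_of Y) \<and>
        connectedin (mtopology_of X) K \<longrightarrow>
          (\<forall>f. continuous_map (mtopology_of X) (mtopology_of Y) f \<longrightarrow> dis X Y f \<ge> ediam X K) \<and>
          2 * dGHc X Y \<ge> ediam X K) \<and>
     (\<forall>Y :: 'b metric.
        mspace Y \<noteq> {} \<and> totally_disconnected_space (mtopology_of Y) \<and>
        connected_space (mtopology_of X) \<and>
        ediam X (mspace X) \<ge> ediam Y (mspace Y) \<longrightarrow>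
          2 * dGHc X Y = ediam X (mspace X)) \<and>
     (\<forall>\<epsilon> N.
        connected_space (mtopology_of X) \<and> eps_net X \<epsilon> N \<and> discrete_subset X N \<longrightarrow>
          2 * dGHc X (submetric X N) = ediam X (mspace X))"
proof (intro conjI allI impI)
  fix \<epsilon> N
  assume *: "connected_space (mtopology_of X) \<and> eps_net X \<epsilon> N \<and> discrete_subset X N"
  \<comment> \<open>Some point of \<open>X\<close> exists, and the net contains a point within
    \<epsilon> of it.\<close>
  have "mspace (submetric X N) \<noteq> {}"
    using * assms by (fastforce simp: eps_net_def)
  \<comment> \<open>The metric topology of the subspace is the subspace topology, which is discrete
    by assumption.\<close>
  moreover have "totally_disconnected_space (mtopology_of (submetric X N))"
    using * totally_disconnected_space_discrete_topology[of N]
    by (simp add: discrete_subset_def mtopology_of_submetric)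
  ultimately show "2 * dGHc X (submetric X N) = ediam X (mspace X)"
    using * assms by (intro two_times_dGHc_eq_ediam ediam_submetric_le) auto
qed (use assms in \<open>auto intro: ediam_le_dis ediam_le_two_times_dGHc two_times_dGHc_eq_ediam\<close>)

end
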